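(* Let $\mathcal{A}$ be a unital complex algebra, $\psi,\varphi:\mathcal{A}\to\mathbb{C}$ unital linear functionals, $\omega:\mathcal{A}\to\mathbb{C}$ a tracial linear functional, and let $a,b\in\mathcal{A}$ be cyclically conditionally free relatively to $(\psi,\varphi,\omega)$. Let $W_a,W_b$ be the subordination series, $W_a=(G_a^\psi)^{\langle-1\rangle}\circ G^\psi_{a+b}$ and $W_b=(G_b^\psi)^{\langle-1\rangle}\circ G^\psi_{a+b}$. Then, as formal Laurent series, $$\begin{aligned}G^\omega_{a+b}(z)=\;&G^\omega_a(W_a(z))W_a'(z)+G^\omega_b(W_b(z))W_b'(z)-(1-\omega(1_{\mathcal{A}}))\frac{(G^\psi_{a+b})'(z)}{G^\psi_{a+b}(z)}\\&+\frac{(G^\varphi_a)'(W_a(z))}{G^\varphi_a(W_a(z))}W_a'(z)+\frac{(G^\varphi_b)'(W_b(z))}{G^\varphi_b(W_b(z))}W_b'(z)-\frac{(G^\varphi_{a+b})'(z)}{G^\varphi_{a+b}(z)}.\end{aligned}$$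
   Context: Formal Cauchy transforms, as formal Laurent series in $1/z$: for $x\in\mathcal{A}$, $G_x^\psi(z)=\frac1z+\sum_{n\ge1}\frac{\psi(x^n)}{z^{n+1}}$, $G_x^\varphi(z)=\frac1z+\sum_{n\ge1}\frac{\varphi(x^n)}{z^{n+1}}$, $G_x^\omega(z)=\frac{\omega(1_{\mathcal{A}})}z+\sum_{n\ge1}\frac{\omega(x^n)}{z^{n+1}}$. $(\cdot)^{\langle-1\rangle}$ denotes compositional inverse; thus $W_a(z)$ is the unique series of the form $z+\sum_{k\ge0}c_kz^{-k}$ with $G^\psi_a(W_a(z))=G^\psi_{a+b}(z)$, and similarly for $W_b$. Primes denote formal derivatives in $z$. Elements $a,b$ are cyclically conditionally free relatively to $(\psi,\varphi,\omega)$ if the unital subalgebras $\mathcal{A}_1,\mathcal{A}_2$ they generate are, meaning: for all $c_k\in\mathcal{A}_{j_k}$, $1\le k\le n$, with $\psi(c_k)=0$ for all $k$ and $j_k\ne j_{k+1}$ for $1\le k\le n-1$, one has $\psi(c_1\cdots c_n)=0$ and $\varphi(c_1\cdots c_n)=\varphi(c_1)\cdots\varphi(c_n)$; and if moreover $n\ge2$ and $j_n\neq j_1$, then $\omega(c_1\cdots c_n)=\varphi(c_1)\cdots\varphi(c_n)$. *)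

theory Defs
  imports Complex_Main "HOL-Computational_Algebra.Computational_Algebra"
begin

unbundle Formal_Power_Series.fps_syntax
unbundle Formal_Laurent_Series.fps_syntax

text \<open>A unital complex algebra on the type \<open>'a\<close>. The axiom \<open>0 \<noteq> 1\<close> of class
  \<^class>\<open>ring_1\<close> costs no generality in the presence of a linear functional with value 1 at 1.\<close>

locale unital_complex_algebra = vector_space scale
  for scale :: "complex \<Rightarrow> 'a::ring_1 \<Rightarrow> 'a" +
  assumes scale_mult_left: "scale c x * y = scale c (x * y)"
    and scale_mult_right: "x * scale c y = scale c (x * y)"

definition linear_functional :: "(complex \<Rightarrow> 'a::ring_1 \<Rightarrow> 'a) \<Rightarrow> ('a \<Rightarrow> complex) \<Rightarrow> bool" where
  "linear_functional scale f \<longleftrightarrow> Vector_Spaces.linear scale (*) f"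

definition tracial :: "('a::ring_1 \<Rightarrow> complex) \<Rightarrow> bool" where
  "tracial f \<longleftrightarrow> (\<forall>x y. f (x * y) = f (y * x))"

definition unital_subalgebra :: "(complex \<Rightarrow> 'a::ring_1 \<Rightarrow> 'a) \<Rightarrow> 'a set \<Rightarrow> bool" where
  "unital_subalgebra scale S \<longleftrightarrow> 1 \<in> S \<and>
     (\<forall>x\<in>S. \<forall>y\<in>S. x + y \<in> S \<and> x * y \<in> S) \<and> (\<forall>c. \<forall>x\<in>S. scale c x \<in> S)"

definition generated_subalgebra :: "(complex \<Rightarrow> 'a::ring_1 \<Rightarrow> 'a) \<Rightarrow> 'a set \<Rightarrow> 'a set" where
  "generated_subalgebra scale X = unital_subalgebra scale hull X"

lemma unital_subalgebra_generated: "unital_subalgebra scale (generated_subalgebra scale X)"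
  unfolding generated_subalgebra_def by (rule hull_in) (auto simp: unital_subalgebra_def)

text \<open>The two subalgebras are \<open>A 1\<close> and \<open>A 2\<close>. The noncommutative product
  \<open>c 1 \<cdots> c n\<close> is a \<^const>\<open>prod_list\<close>, in this order.\<close>

definition cyclically_cond_free ::
  "('a::ring_1 \<Rightarrow> complex) \<Rightarrow> ('a \<Rightarrow> complex) \<Rightarrow> ('a \<Rightarrow> complex) \<Rightarrow> (nat \<Rightarrow> 'a set) \<Rightarrow> bool" where
  "cyclically_cond_free \<psi> \<phi> \<omega> A \<longleftrightarrow>
     (\<forall>n::nat. \<forall>j :: nat \<Rightarrow> nat. \<forall>c :: nat \<Rightarrow> 'a.
        n \<ge> 1 \<and> (\<forall>k\<in>{1..n}. j k \<in> {1, 2} \<and> c k \<in> A (j k) \<and> \<psi> (c k) = 0) \<and>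
        (\<forall>k. 1 \<le> k \<and> k < n \<longrightarrow> j k \<noteq> j (k + 1))
        \<longrightarrow> \<psi> (prod_list (map c [1..<n+1])) = 0 \<and>
            \<phi> (prod_list (map c [1..<n+1])) = (\<Prod>k=1..n. \<phi> (c k)) \<and>
            (n \<ge> 2 \<and> j n \<noteq> j 1 \<longrightarrow>
               \<omega> (prod_list (map c [1..<n+1])) = (\<Prod>k=1..n. \<phi> (c k))))"

definition cyclically_cond_free_elements ::
  "(complex \<Rightarrow> 'a::ring_1 \<Rightarrow> 'a) \<Rightarrow> ('a \<Rightarrow> complex) \<Rightarrow> ('a \<Rightarrow> complex) \<Rightarrow> ('a \<Rightarrow> complex) \<Rightarrow>
   'a \<Rightarrow> 'a \<Rightarrow> bool" where
  "cyclically_cond_free_elements scale \<psi> \<phi> \<omega> a b \<longleftrightarrow>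
     cyclically_cond_free \<psi> \<phi> \<omega> (\<lambda>j. generated_subalgebra scale {if j = 1 then a else b})"

text \<open>
  A formal Laurent series in \<open>1/z\<close> is an element of \<^typ>\<open>complex fls\<close> whose indeterminate
  \<^const>\<open>fls_X\<close> stands for \<open>1/z\<close>: the coefficient of \<open>z\<^sup>-\<^sup>n\<close> in \<open>F\<close> is \<open>F $$ n\<close>, and \<open>z\<close> itself
  is \<^const>\<open>fls_X_inv\<close>.

  The Cauchy transform is \<open>\<Sum>n\<ge>0. f (x\<^sup>n) z\<^sup>-\<^sup>n\<^sup>-\<^sup>1\<close>; its leading coefficient is \<open>f 1\<close>, which is 1
  when \<open>f\<close> is unital.
\<close>

definition cauchy_fps :: "('a::ring_1 \<Rightarrow> complex) \<Rightarrow> 'a \<Rightarrow> complex fps" where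
  "cauchy_fps f x = fps_X * Abs_fps (\<lambda>n. f (x ^ n))"

definition cauchy :: "('a::ring_1 \<Rightarrow> complex) \<Rightarrow> 'a \<Rightarrow> complex fls" where
  "cauchy f x = fps_to_fls (cauchy_fps f x)"

lemma cauchy_nth: "cauchy f x $$ n = (if n \<ge> 1 then f (x ^ nat (n - 1)) else 0)"
  by (auto simp: cauchy_def cauchy_fps_def nat_diff_distrib)

text \<open>\<open>d/dz = - X\<^sup>2 d/dX\<close> for \<open>X = 1/z\<close>.\<close>

definition zderiv :: "complex fls \<Rightarrow> complex fls" where
  "zderiv F = - (fls_X ^ 2 * fls_deriv F)"

lemma zderiv_nth: "zderiv F $$ n = - of_int (n - 1) * F $$ (n - 1)"
proof -
  have "fls_X ^ 2 * fls_deriv F = fls_X * (fls_X * fls_deriv F)"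
    by (simp only: power2_eq_square mult.assoc)
  also have "\<dots> = fls_shift (-1) (fls_shift (-1) (fls_deriv F))"
    by (simp only: fls_X_times_conv_shift)
  finally show ?thesis
    by (simp add: zderiv_def algebra_simps)
qed

text \<open>\<open>F(W(z))\<close> for \<open>W(z) = z + \<Sum>k\<ge>0. c\<^sub>k z\<^sup>-\<^sup>k\<close>: the series \<open>1/W\<close> is a power series
  in \<open>1/z\<close> without constant term, which is substituted for the indeterminate \<open>1/z\<close> of \<open>F\<close>.\<close>

definition zcompose :: "complex fls \<Rightarrow> complex fls \<Rightarrow> complex fls" where
  "zcompose F W = fls_compose_fps F (fls_regpart (inverse W))"

text \<open>If \<open>G(z) = g(1/z)\<close> with \<open>g(0) = 0\<close> and \<open>g'(0) \<noteq> 0\<close>, then \<open>G(K(w)) = w\<close> is solved by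
  \<open>K(w) = 1 / g\<^sup>-\<^sup>1(w)\<close>, a Laurent series in \<open>w\<close> with a simple pole. Here the indeterminate of
  the result is \<open>w\<close>, not \<open>1/z\<close>.\<close>

definition comp_inverse :: "complex fps \<Rightarrow> complex fls" where
  "comp_inverse g = inverse (fps_to_fls (fps_inv g))"

text \<open>\<open>subordination f x s\<close> is the compositional inverse of the Cauchy transform of \<open>x\<close>
  composed with the Cauchy transform of \<open>s\<close>.\<close>

definition subordination :: "('a::ring_1 \<Rightarrow> complex) \<Rightarrow> 'a \<Rightarrow> 'a \<Rightarrow> complex fls" where
  "subordination f x s = fls_compose_fps (comp_inverse (cauchy_fps f x)) (cauchy_fps f s)"

lemma cauchy_fps_0_1 [simp]: "cauchy_fps f x $ 0 = 0" "cauchy_fps f x $ Suc 0 = f 1"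
  by (simp_all add: cauchy_fps_def)

lemma inverse_eq_fps:
  assumes "W $$ (-1) = (1::complex)" and "\<And>n. n < -1 \<Longrightarrow> W $$ n = 0"
  obtains u where "inverse W = fps_to_fls u" "u $ 0 = 0" "u $ 1 = 1"
proof -
  have sd: "fls_subdegree W = -1"
    using assms by (intro fls_subdegree_eqI) auto
  then have sd': "fls_subdegree (inverse W) = 1"
    by (simp add: fls_inverse_subdegree)
  have 1: "inverse W = fps_to_fls (fls_regpart (inverse W))"
    using sd' by simp
  have "inverse W $$ 1 = 1"
    using fls_inverse_subdegree_base_nonzero[of W] fls_inverse_subdegree_base[of W] sd assms(1) by auto
  moreover have "inverse W $$ 0 = 0" using sd' by simp
  ultimately show ?thesis using that[of "fls_regpart (inverse W)"] 1 by simp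
qed

lemma
  fixes f :: "'a::ring_1 \<Rightarrow> complex"
  assumes "f 1 = 1"
  shows subordination_eq: "zcompose (cauchy f x) (subordination f x s) = cauchy f s"
    and subordination_nth_minus_1: "subordination f x s $$ (-1) = 1"
    and subordination_nth_less: "n < -1 \<Longrightarrow> subordination f x s $$ n = 0"
    and subordination_unique:
      "\<lbrakk>W $$ (-1) = 1; \<And>n. n < -1 \<Longrightarrow> W $$ n = 0; zcompose (cauchy f x) W = cauchy f s\<rbrakk>
        \<Longrightarrow> W = subordination f x s"
proof -
  define g h where "g = cauchy_fps f x" and "h = cauchy_fps f s"
  have g [simp]: "g $ 0 = 0" "g $ Suc 0 = 1" and h [simp]: "h $ 0 = 0" "h $ Suc 0 = 1"
    using assms by (simp_all add: g_def h_def)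
  have i0 [simp]: "fps_inv g $ 0 = 0" by (simp add: fps_inv_def)
  have i1 [simp]: "fps_inv g $ Suc 0 = 1" by (simp add: fps_inv_def)
  have hne: "h \<noteq> 0" using h by (metis fps_zero_nth zero_neq_one)
  define u where "u = fps_inv g oo h"
  have u0 [simp]: "u $ 0 = 0" by (simp add: u_def)
  have u1 [simp]: "u $ Suc 0 = 1"
    by (simp add: u_def fps_compose_nth)
  have W: "subordination f x s = inverse (fps_to_fls u)"
    using hne by (simp add: subordination_def comp_inverse_def u_def fls_compose_fps_inverse
        flip: g_def h_def)
  have une: "u \<noteq> 0" using u1 by (metis fps_zero_nth zero_neq_one)
  have "g oo u = (g oo fps_inv g) oo h" unfolding u_def by (rule fps_compose_assoc) simp_all
  also have "\<dots> = h" by (simp add: fps_inv_right)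
  finally show "zcompose (cauchy f x) (subordination f x s) = cauchy f s"
    using une by (simp add: zcompose_def W cauchy_def flip: g_def h_def)
  have sdu: "fls_subdegree (fps_to_fls u) = 1"
    by (rule fls_subdegree_eqI) (auto simp: fps_to_fls_nth)
  then have sd: "fls_subdegree (subordination f x s) = -1"
    by (simp add: W fls_inverse_subdegree)
  then show "n < -1 \<Longrightarrow> subordination f x s $$ n = 0" by simp
  show "subordination f x s $$ (-1) = 1"
    using fls_inverse_subdegree_base[of "fps_to_fls u"] sdu by (simp add: W)
  show "W = subordination f x s"
    if W': "W $$ (-1) = 1" "\<And>n. n < -1 \<Longrightarrow> W $$ n = 0" "zcompose (cauchy f x) W = cauchy f s" for W
  proof -
    obtain v where v: "inverse W = fps_to_fls v" "v $ 0 = 0" "v $ 1 = 1"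
      using inverse_eq_fps[OF W'(1,2)] by blast
    have "v \<noteq> 0" using v(3) by auto
    then have "fps_to_fls (g oo v) = fps_to_fls h"
      using W'(3) v by (simp add: zcompose_def cauchy_def flip: g_def h_def)
    then have gv: "g oo v = h" by simp
    have "u = (fps_inv g oo g) oo v"
      unfolding u_def gv[symmetric] by (rule fps_compose_assoc) (simp_all add: v)
    also have "\<dots> = v" by (simp add: fps_inv v)
    finally have "inverse W = fps_to_fls u" using v by simp
    then show ?thesis unfolding W by (metis inverse_inverse_eq)
  qed
qed

unbundle no Formal_Power_Series.fps_syntax
unbundle no Formal_Laurent_Series.fps_syntax

end

theory Submission
  imports Defs
begin

text \<open>All computations take place in power series in \<open>X = 1/z\<close> over the algebra, to which the
  functionals and their multiplicativity on alternating words extend coefficientwise.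
  Let \<open>H\<close> be the \<open>\<psi>\<close>-Cauchy transform of \<open>a + b\<close>, put \<open>M\<^sub>a = H (W\<^sub>a - a)\<close>, \<open>M\<^sub>b = H (W\<^sub>b - b)\<close>,
  and write their inverses as \<open>1 + x\<close> and \<open>1 + y\<close>; then \<open>\<psi>\<close> vanishes on \<open>x\<close> and \<open>y\<close>. If
  \<open>Z = W\<^sub>a + W\<^sub>b - 1/H\<close>, then \<open>H (Z - a - b) = M\<^sub>a + M\<^sub>b - 1 = M\<^sub>a (1 - x y) M\<^sub>b\<close>, so that
  \<open>(1 + y) (1 - x y)\<^sup>-\<^sup>1 (1 + x)\<close> is the inverse of \<open>H (Z - a - b)\<close>, a sum of alternating words.
  Its value under \<open>\<psi>\<close> is 1, which forces \<open>Z = z\<close>. With \<open>\<xi> = \<phi> x\<close> and \<open>\<eta> = \<phi> y\<close>,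
  its value under \<open>\<phi>\<close> is \<open>(1 + \<xi>) (1 + \<eta>) / (1 - \<xi> \<eta>)\<close>. Since \<open>\<omega>\<close> is a trace, \<open>\<omega>\<close> of the
  logarithmic derivative of \<open>M\<^sub>a (1 - x y) M\<^sub>b\<close> is the sum over the three factors; the middle one
  gives \<open>- (\<xi> \<eta>)' / (1 - \<xi> \<eta>)\<close> by cyclic conditional freeness. Comparison with the logarithmic
  derivative of the formula for \<open>\<phi>\<close> eliminates \<open>\<xi>\<close> and \<open>\<eta>\<close>.\<close>

unbundle Formal_Power_Series.fps_syntax

section \<open>Geometric series over a noncommutative ring\<close>

lemma left_inverse_eq_right_inverse:
  fixes x :: "'a::monoid_mult"
  assumes "y * x = 1" "x * z = 1"
  shows "y = z"
  by (metis assms mult.assoc mult_1_left mult_1_right)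

text \<open>If \<open>z $ 0 = 0\<close>, the powers \<open>z ^ k\<close> with k > n contribute
  nothing in order n. Cutting the sum at \<open>k \<le> n\<close> therefore makes each coefficient
  of the geometric series a finite sum.\<close>

definition geo :: "'a::ring_1 fps \<Rightarrow> 'a fps" where
  "geo z = Abs_fps (\<lambda>n. (\<Sum>k\<le>n. (z ^ k) $ n))"

text \<open>Every cutoff beyond n gives the same coefficient, so inside a product one partial sum
  can replace \<open>geo z\<close> in all orders up to n at once.\<close>

lemma geo_nth:
  assumes "z $ 0 = 0" "n < N"
  shows "geo z $ n = (\<Sum>k<N. z ^ k) $ n"
proof -
  have "geo z $ n = (\<Sum>k\<le>n. (z ^ k) $ n)" by (simp add: geo_def)
  also have "\<dots> = (\<Sum>k<N. (z ^ k) $ n)"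
    using assms startsby_zero_power_prefix[OF assms(1)]
    by (intro sum.mono_neutral_left) auto
  finally show ?thesis by (simp add: fps_sum_nth)
qed

lemma mult_sum_powers:
  fixes z :: "'a::ring_1"
  shows "(1 - z) * (\<Sum>k<N. z ^ k) = 1 - z ^ N" "(\<Sum>k<N. z ^ k) * (1 - z) = 1 - z ^ N"
proof -
  show *: "(1 - z) * (\<Sum>k<N. z ^ k) = 1 - z ^ N"
  proof (induction N)
    case (Suc N)
    then show ?case by (simp add: distrib_left left_diff_distrib)
  qed simp
  have "z * (\<Sum>k<N. z ^ k) = (\<Sum>k<N. z ^ k) * z"
    by (simp add: sum_distrib_left sum_distrib_right power_commutes)
  then show "(\<Sum>k<N. z ^ k) * (1 - z) = 1 - z ^ N"
    using * by (simp add: algebra_simps)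
qed

lemma geo_inverse:
  fixes z :: "'a::ring_1 fps"
  assumes "z $ 0 = 0"
  shows "(1 - z) * geo z = 1" "geo z * (1 - z) = 1"
proof -
  have p: "(z ^ Suc n) $ n = 0" for n
    using startsby_zero_power_prefix[OF assms, of "Suc n"] by blast
  have "((1 - z) * geo z) $ n = ((1 - z) * (\<Sum>k<Suc n. z ^ k)) $ n" for n
    unfolding fps_mult_nth by (intro sum.cong refl arg_cong2[of _ _ _ _ "(*)"] geo_nth assms) auto
  then show "(1 - z) * geo z = 1"
    unfolding mult_sum_powers fps_eq_iff by (simp add: p del: power_Suc)
  have "(geo z * (1 - z)) $ n = ((\<Sum>k<Suc n. z ^ k) * (1 - z)) $ n" for n
    unfolding fps_mult_nth by (intro sum.cong refl arg_cong2[of _ _ _ _ "(*)"] geo_nth assms) auto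
  then show "geo z * (1 - z) = 1"
    unfolding mult_sum_powers fps_eq_iff by (simp add: p del: power_Suc)
qed

section \<open>Coefficientwise extension of functionals\<close>

definition coeffwise :: "('a::zero \<Rightarrow> 'b::zero) \<Rightarrow> 'a fps \<Rightarrow> 'b fps" where
  "coeffwise f F = Abs_fps (\<lambda>n. f (F $ n))"

lemma coeffwise_nth [simp]: "coeffwise f F $ n = f (F $ n)"
  by (simp add: coeffwise_def)

text \<open>The indeterminate is central, so traciality can be applied to each pair of coefficients;
  reversing the Cauchy sum then restores its order.\<close>

lemma coeffwise_commute:
  assumes "additive f" "tracial f"
  shows "coeffwise f (F * G) = coeffwise f (G * F)"
proof (rule fps_ext)
  fix n
  have "coeffwise f (F * G) $ n = (\<Sum>i=0..n. f (F $ i * G $ (n - i)))"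
    by (simp add: fps_mult_nth additive.sum[OF assms(1)])
  also have "\<dots> = (\<Sum>i=0..n. f (G $ (n - i) * F $ i))"
    using assms(2) by (simp add: tracial_def)
  also have "\<dots> = (\<Sum>i=0..n. f (G $ i * F $ (n - i)))"
    by (rule sum.reindex_bij_witness[of _ "\<lambda>i. n - i" "\<lambda>i. n - i"]) auto
  also have "\<dots> = coeffwise f (G * F) $ n"
    by (simp add: fps_mult_nth additive.sum[OF assms(1)])
  finally show "coeffwise f (F * G) $ n = coeffwise f (G * F) $ n" .
qed

text \<open>A product formula for words with one coefficient taken from each series passes to the
  product of the series. The prefix \<open>e\<close> and the constant \<open>\<gamma>\<close> are
  there for the induction: each coefficient of the first series is absorbed into \<open>e\<close>,
  and its value under \<open>g\<close> into \<open>\<gamma>\<close>.\<close>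

lemma coeffwise_prod_list:
  fixes f g :: "'a::ring_1 \<Rightarrow> complex"
  assumes "additive f"
    and "\<And>cs. list_all2 (\<lambda>c F. c \<in> range (fps_nth F)) cs Fs
           \<Longrightarrow> f (e * prod_list cs) = \<gamma> * prod_list (map g cs)"
  shows "coeffwise f (fps_const e * prod_list Fs) = fps_const \<gamma> * prod_list (map (coeffwise g) Fs)"
  using assms(2)
proof (induction Fs arbitrary: e \<gamma>)
  case Nil
  then have "f e = \<gamma>" by simp
  then show ?case using additive.zero[OF assms(1)] by (simp add: fps_eq_iff)
next
  case (Cons F Fs)
  have IH: "coeffwise f (fps_const (e * F $ i) * prod_list Fs) $ m
      = (\<gamma> * g (F $ i)) * prod_list (map (coeffwise g) Fs) $ m" for i m
  proof -
    have "coeffwise f (fps_const (e * F $ i) * prod_list Fs)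
      = fps_const (\<gamma> * g (F $ i)) * prod_list (map (coeffwise g) Fs)"
    proof (rule Cons.IH)
      fix cs assume "list_all2 (\<lambda>c F. c \<in> range (fps_nth F)) cs Fs"
      then show "f (e * F $ i * prod_list cs) = \<gamma> * g (F $ i) * prod_list (map g cs)"
        using Cons.prems[of "F $ i # cs"] by (simp add: mult.assoc)
    qed
    then show ?thesis by simp
  qed
  have "coeffwise f (fps_const e * prod_list (F # Fs)) $ n
      = (fps_const \<gamma> * prod_list (map (coeffwise g) (F # Fs))) $ n" for n
  proof -
    have "coeffwise f (fps_const e * prod_list (F # Fs)) $ n
        = (\<Sum>i=0..n. f (e * (F $ i * prod_list Fs $ (n - i))))"
      by (simp add: fps_mult_nth[of F] sum_distrib_left additive.sum[OF assms(1)])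
    also have "\<dots> = (\<Sum>i=0..n. \<gamma> * (g (F $ i) * prod_list (map (coeffwise g) Fs) $ (n - i)))"
      using IH by (intro sum.cong refl) (simp add: mult.assoc)
    also have "\<dots> = (fps_const \<gamma> * prod_list (map (coeffwise g) (F # Fs))) $ n"
      by (simp add: fps_mult_nth[of "coeffwise g F"] sum_distrib_left)
    finally show ?thesis .
  qed
  then show ?case by (rule fps_ext)
qed

text \<open>Up to order n both geometric series are partial sums of equal length, so the formula for
  powers can be summed term by term. The factor \<open>1 - \<zeta>\<close> avoids a
  quotient.\<close>

lemma coeffwise_geo:
  fixes f :: "'a::ring_1 \<Rightarrow> complex"
  assumes "additive f" "z $ 0 = 0" "\<zeta> $ 0 = 0"
    and pow: "\<And>k. coeffwise f (c * z ^ k * d) = \<gamma> * \<zeta> ^ k"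
  shows "coeffwise f (c * geo z * d) * (1 - \<zeta>) = \<gamma>"
proof -
  have "coeffwise f (c * geo z * d) $ n = (\<gamma> * geo \<zeta>) $ n" for n
  proof -
    have "(c * geo z * d) $ n = (c * (\<Sum>k<Suc n. z ^ k) * d) $ n"
      unfolding fps_mult_nth
      by (intro sum.cong refl arg_cong2[of _ _ _ _ "(*)"] geo_nth assms) auto
    also have "\<dots> = (\<Sum>k<Suc n. (c * z ^ k * d) $ n)"
      by (simp add: sum_distrib_left sum_distrib_right fps_sum_nth distrib_left distrib_right)
    finally have "coeffwise f (c * geo z * d) $ n = (\<Sum>k<Suc n. coeffwise f (c * z ^ k * d) $ n)"
      by (simp add: additive.sum[OF assms(1)] additive.add[OF assms(1)])
    also have "\<dots> = (\<gamma> * (\<Sum>k<Suc n. \<zeta> ^ k)) $ n"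
      by (simp add: pow sum_distrib_left fps_sum_nth distrib_left)
    also have "\<dots> = (\<gamma> * geo \<zeta>) $ n"
      unfolding fps_mult_nth
      by (intro sum.cong refl arg_cong2[of _ _ _ _ "(*)"] geo_nth[symmetric] assms) auto
    finally show ?thesis .
  qed
  then have "coeffwise f (c * geo z * d) = \<gamma> * geo \<zeta>" by (rule fps_ext)
  then show ?thesis by (simp add: mult.assoc geo_inverse assms)
qed

section \<open>Alternating words and cyclic conditional freeness\<close>

definition alternating :: "(nat \<times> 'a) list \<Rightarrow> bool" where
  "alternating ws \<longleftrightarrow> distinct_adj (map fst ws)"

lemma alternating_Nil [simp]: "alternating []"
  by (simp add: alternating_def)

lemma alternating_Cons [simp]:
  "alternating (p # ws) \<longleftrightarrow> ws = [] \<or> fst p \<noteq> fst (hd ws) \<and> alternating ws"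
  by (cases ws) (auto simp: alternating_def)

lemma cyclically_cond_free_word:
  assumes "cyclically_cond_free \<psi> \<phi> \<omega> A" and "ws \<noteq> []" and "alternating ws"
    and "\<And>j c. (j, c) \<in> set ws \<Longrightarrow> j \<in> {1, 2} \<and> c \<in> A j \<and> \<psi> c = 0"
  shows "\<psi> (prod_list (map snd ws)) = 0"
    and "\<phi> (prod_list (map snd ws)) = prod_list (map \<phi> (map snd ws))"
    and "fst (hd ws) \<noteq> fst (last ws) \<Longrightarrow>
           \<omega> (prod_list (map snd ws)) = prod_list (map \<phi> (map snd ws))"
proof -
  define n where "n = length ws"
  \<comment> \<open>A word lists letters tagged by the index of their algebra. Freeness counts
    letters from 1 while list positions start at 0, hence the shift.\<close>
  define j where "j k = fst (ws ! (k - 1))" for k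
  define c where "c k = snd (ws ! (k - 1))" for k
  have n: "n \<ge> 1" using assms(2) by (simp add: n_def Suc_le_eq)
  have 1: "\<forall>k\<in>{1..n}. j k \<in> {1, 2} \<and> c k \<in> A (j k) \<and> \<psi> (c k) = 0"
  proof
    fix k assume "k \<in> {1..n}"
    then have "ws ! (k - 1) \<in> set ws" by (intro nth_mem) (auto simp: n_def)
    then show "j k \<in> {1, 2} \<and> c k \<in> A (j k) \<and> \<psi> (c k) = 0"
      using assms(4)[of "j k" "c k"] by (simp add: j_def c_def)
  qed
  have 2: "\<forall>k. 1 \<le> k \<and> k < n \<longrightarrow> j k \<noteq> j (k + 1)"
  proof (intro allI impI)
    fix k assume "1 \<le> k \<and> k < n"
    then show "j k \<noteq> j (k + 1)"
      using assms(3) by (auto simp: alternating_def distinct_adj_conv_nth j_def n_def dest: spec[of _ "k - 1"])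
  qed
  have m: "map c [1..<n+1] = map snd ws"
    by (rule nth_equalityI) (auto simp: c_def n_def simp del: upt_Suc)
  have "(\<Prod>k=1..n. \<phi> (c k)) = prod_list (map \<phi> (map c [1..<n+1]))"
    by (simp add: prod.distinct_set_conv_list[symmetric] atLeastLessThanSuc_atLeastAtMost del: upt_Suc)
  then have pr: "(\<Prod>k=1..n. \<phi> (c k)) = prod_list (map \<phi> (map snd ws))" unfolding m .
  have "\<psi> (prod_list (map snd ws)) = 0 \<and>
            \<phi> (prod_list (map snd ws)) = prod_list (map \<phi> (map snd ws)) \<and>
            (n \<ge> 2 \<and> j n \<noteq> j 1 \<longrightarrow>
               \<omega> (prod_list (map snd ws)) = prod_list (map \<phi> (map snd ws)))"
    using assms(1)[unfolded cyclically_cond_free_def, rule_format, of n j c] n 1 2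
    unfolding m pr by simp
  moreover have "j 1 = fst (hd ws)" "j n = fst (last ws)"
    using assms(2) by (simp_all add: j_def n_def hd_conv_nth last_conv_nth)
  \<comment> \<open>Different tags at the two ends exclude one-letter words, which yields the length
    bound in the cyclic clause.\<close>
  moreover have "n \<ge> 2" if "fst (hd ws) \<noteq> fst (last ws)"
    using that assms(2) by (cases ws; cases "tl ws") (auto simp: n_def)
  ultimately show "\<psi> (prod_list (map snd ws)) = 0"
    "\<phi> (prod_list (map snd ws)) = prod_list (map \<phi> (map snd ws))"
    "fst (hd ws) \<noteq> fst (last ws) \<Longrightarrow>
           \<omega> (prod_list (map snd ws)) = prod_list (map \<phi> (map snd ws))"
    by auto
qed


abbreviation xy_word :: "'a \<Rightarrow> 'a \<Rightarrow> nat \<Rightarrow> (nat \<times> 'a) list" where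
  "xy_word x y k \<equiv> concat (replicate k [(1, x), (2, y)])"

lemma hd_xy_word:
  assumes "ws \<noteq> [] \<Longrightarrow> fst (hd ws) = 1" "xy_word x y k @ ws \<noteq> []"
  shows "fst (hd (xy_word x y k @ ws)) = 1"
  using assms by (cases k) auto

lemma alternating_xy_word:
  assumes "alternating ws" "ws \<noteq> [] \<Longrightarrow> fst (hd ws) = 1"
  shows "alternating (xy_word x y k @ ws)"
proof (induction k)
  case (Suc k)
  moreover have "xy_word x y k @ ws = [] \<or> fst (hd (xy_word x y k @ ws)) = 1"
    using hd_xy_word[OF assms(2), of k x y] by blast
  ultimately show ?case by auto
qed (use assms in simp)

lemma prod_list_xy_word:
  "prod_list (map f (us @ xy_word x y k @ ws))
    = prod_list (map f us) * ((f (1, x) * f (2, y)) ^ k * prod_list (map f ws))"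
proof -
  have "prod_list (map f (xy_word x y k)) = (f (1, x) * f (2, y)) ^ k"
    by (induction k) (simp_all add: mult.assoc)
  then show ?thesis by simp
qed

text \<open>Choosing one coefficient from each series keeps the tags and the vanishing of
  \<open>\<psi>\<close>, so every such choice is again an alternating centred word and the product
  formulas pass to series.\<close>

lemma cyclically_cond_free_series:
  fixes \<psi> \<phi> \<omega> :: "'a::ring_1 \<Rightarrow> complex" and ws :: "(nat \<times> 'a fps) list"
  assumes "additive \<psi>" "additive \<phi>" "additive \<omega>"
    and "cyclically_cond_free \<psi> \<phi> \<omega> A" and "ws \<noteq> []" and "alternating ws"
    and "\<And>j F n. (j, F) \<in> set ws \<Longrightarrow> j \<in> {1, 2} \<and> F $ n \<in> A j \<and> \<psi> (F $ n) = 0"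
  shows "coeffwise \<psi> (prod_list (map snd ws)) = 0"
    and "coeffwise \<phi> (prod_list (map snd ws)) = prod_list (map (coeffwise \<phi>) (map snd ws))"
    and "fst (hd ws) \<noteq> fst (last ws) \<Longrightarrow>
           coeffwise \<omega> (prod_list (map snd ws)) = prod_list (map (coeffwise \<phi>) (map snd ws))"
proof -
  have *: "\<psi> (prod_list cs) = 0 \<and> \<phi> (prod_list cs) = prod_list (map \<phi> cs) \<and>
     (fst (hd ws) \<noteq> fst (last ws) \<longrightarrow> \<omega> (prod_list cs) = prod_list (map \<phi> cs)) \<and> 0 \<in> set (map \<psi> cs)"
    if cs: "list_all2 (\<lambda>c F. c \<in> range (fps_nth F)) cs (map snd ws)" for cs
  proof -
    define vs where "vs = zip (map fst ws) cs"
    have len: "length cs = length ws"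
      using cs by (auto dest: list_all2_lengthD)
    have snd: "map snd vs = cs" and fst: "map fst vs = map fst ws"
      by (simp_all add: vs_def len)
    have ne: "vs \<noteq> []" using fst assms(5) by auto
    have "alternating vs"
      using assms(6) fst by (simp add: alternating_def)
    moreover have el: "j \<in> {1, 2} \<and> c \<in> A j \<and> \<psi> c = 0" if jc: "(j, c) \<in> set vs" for j c
    proof -
      obtain i where i: "i < length ws" "j = fst (ws ! i)" "c = cs ! i"
        using jc by (auto simp: vs_def set_zip)
      have "c \<in> range (fps_nth (snd (ws ! i)))"
        using list_all2_nthD[OF cs, of i] i len by simp
      then obtain n where "c = snd (ws ! i) $ n" by auto
      moreover have "(fst (ws ! i), snd (ws ! i)) \<in> set ws" using i by simp
      ultimately show ?thesis using assms(7) i by blast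
    qed
    ultimately have "\<psi> (prod_list (map snd vs)) = 0"
      "\<phi> (prod_list (map snd vs)) = prod_list (map \<phi> (map snd vs))"
      "fst (hd vs) \<noteq> fst (last vs) \<Longrightarrow>
           \<omega> (prod_list (map snd vs)) = prod_list (map \<phi> (map snd vs))"
      using cyclically_cond_free_word[OF assms(4) ne] by blast+
    moreover have "fst (hd vs) = fst (hd ws)" "fst (last vs) = fst (last ws)"
      using fst ne assms(5) by (metis hd_map last_map)+
    moreover have "0 \<in> set (map \<psi> cs)"
    proof -
      have "hd vs \<in> set vs" using ne by simp
      then have "\<psi> (snd (hd vs)) = 0" using el[of "fst (hd vs)" "snd (hd vs)"] by simp
      moreover have "snd (hd vs) \<in> set cs" using \<open>hd vs \<in> set vs\<close> snd by (metis image_eqI set_map)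
      ultimately show ?thesis by (auto simp: image_iff intro!: bexI[of _ "snd (hd vs)"])
    qed
    ultimately show ?thesis by (simp add: snd)
  qed
  \<comment> \<open>The constant \<open>\<gamma>\<close> is 0 for \<open>\<psi>\<close>, which kills
    all these words, and 1 for the multiplicative formulas of \<open>\<phi>\<close> and
    \<open>\<omega>\<close>.\<close>
  show "coeffwise \<psi> (prod_list (map snd ws)) = 0"
    using coeffwise_prod_list[OF assms(1), of "map snd ws" 1 0 \<psi>] * by simp
  show "coeffwise \<phi> (prod_list (map snd ws)) = prod_list (map (coeffwise \<phi>) (map snd ws))"
    using coeffwise_prod_list[OF assms(2), of "map snd ws" 1 1 \<phi>] * by simp
  show "coeffwise \<omega> (prod_list (map snd ws)) = prod_list (map (coeffwise \<phi>) (map snd ws))"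
    if "fst (hd ws) \<noteq> fst (last ws)"
    using coeffwise_prod_list[OF assms(3), of "map snd ws" 1 1 \<phi>] * that by simp
qed

text \<open>Expanding the geometric series produces the words \<open>(x * y) ^ k\<close> with an
  optional \<open>y\<close> in front and an optional \<open>x\<close> behind, all alternating. The
  series \<open>x'\<close> and \<open>y'\<close> are later the derivatives of \<open>x\<close> and
  \<open>y\<close>; they are independent here because only centredness and membership
  matter.\<close>

lemma cyclically_cond_free_xy:
  fixes \<psi> \<phi> \<omega> :: "'a::ring_1 \<Rightarrow> complex" and x y x' y' :: "'a fps"
  assumes lin: "additive \<psi>" "additive \<phi>" "additive \<omega>"
    and one: "\<psi> 1 = 1" "\<phi> 1 = 1"
    and free: "cyclically_cond_free \<psi> \<phi> \<omega> A"
    and xy: "\<And>n. x $ n \<in> A 1 \<and> \<psi> (x $ n) = 0" "\<And>n. y $ n \<in> A 2 \<and> \<psi> (y $ n) = 0"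
    and xy': "\<And>n. x' $ n \<in> A 1 \<and> \<psi> (x' $ n) = 0" "\<And>n. y' $ n \<in> A 2 \<and> \<psi> (y' $ n) = 0"
    and 0: "x $ 0 = 0" "y $ 0 = 0"
  defines "\<xi> \<equiv> coeffwise \<phi> x" and "\<eta> \<equiv> coeffwise \<phi> y"
  shows "coeffwise \<psi> ((1 + y) * geo (x * y) * (1 + x)) = 1"
    and "coeffwise \<phi> ((1 + y) * geo (x * y) * (1 + x)) * (1 - \<xi> * \<eta>) = (1 + \<xi>) * (1 + \<eta>)"
    and "coeffwise \<omega> (geo (x * y) * (x' * y + x * y')) * (1 - \<xi> * \<eta>)
          = coeffwise \<phi> x' * \<eta> + \<xi> * coeffwise \<phi> y'"
proof -
  have add: "coeffwise f (F + G) = coeffwise f F + coeffwise f G" if "additive f"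
    for f :: "'a \<Rightarrow> complex" and F G
    by (rule fps_ext) (simp add: additive.add[OF that])
  have wx: "coeffwise f 1 = 1" if "additive f" "f 1 = 1" for f :: "'a \<Rightarrow> complex"
    by (rule fps_ext) (use that additive.zero in auto)
  have xy0: "(x * y) $ 0 = 0" "(\<xi> * \<eta>) $ 0 = 0"
    using 0 by (simp_all add: \<xi>_def additive.zero[OF lin(2)])
  note free' = cyclically_cond_free_series[OF lin free]
  have word: "coeffwise \<psi> (prod_list (map snd (us @ xy_word x y k @ vs)))
      = (if us @ xy_word x y k @ vs = [] then 1 else 0)"
    "coeffwise \<phi> (prod_list (map snd (us @ xy_word x y k @ vs)))
      = prod_list (map (coeffwise \<phi> \<circ> snd) (us @ xy_word x y k @ vs))"
    if "us \<in> {[], [(2, y)]}" "vs \<in> {[], [(1, x)]}" for us vs k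
  proof -
    have alt: "alternating (us @ xy_word x y k @ vs)"
    proof -
      have "alternating (xy_word x y k @ vs)"
        by (rule alternating_xy_word) (use that in auto)
      moreover have "xy_word x y k @ vs = [] \<or> fst (hd (xy_word x y k @ vs)) = 1"
        using that(2) by (cases k) auto
      ultimately show ?thesis
        using that(1) by auto
    qed
    have el: "j \<in> {1, 2} \<and> F $ n \<in> A j \<and> \<psi> (F $ n) = 0"
      if "(j, F) \<in> set (us @ xy_word x y k @ vs)" for j F n
      using that \<open>us \<in> _\<close> \<open>vs \<in> _\<close> xy by (auto split: if_splits)
    show "coeffwise \<psi> (prod_list (map snd (us @ xy_word x y k @ vs)))
      = (if us @ xy_word x y k @ vs = [] then 1 else 0)"
    proof (cases "us @ xy_word x y k @ vs = []")
      case True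
      then show ?thesis by (simp only: True) (simp add: wx lin one)
    next
      case False
      then show ?thesis using free'(1)[OF False alt el] by (simp only: if_False)
    qed
    show "coeffwise \<phi> (prod_list (map snd (us @ xy_word x y k @ vs)))
      = prod_list (map (coeffwise \<phi> \<circ> snd) (us @ xy_word x y k @ vs))"
    proof (cases "us @ xy_word x y k @ vs = []")
      case True
      then show ?thesis by (simp only: True) (simp add: wx lin one)
    next
      case False
      then show ?thesis using free'(2)[OF False alt el] by (simp only: map_map)
    qed
  qed
  have expand: "(1 + y) * (x * y) ^ k * (1 + x)
    = (x * y) ^ k + y * (x * y) ^ k + (x * y) ^ k * x + y * (x * y) ^ k * x" for k
    by (simp add: algebra_simps)
  \<comment> \<open>Only the empty word, which occurs for k = 0, survives under
    \<open>\<psi>\<close>; with 0 ^ 0 = 1 this is a geometric sequence of ratio 0.\<close>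
  have "coeffwise \<psi> ((1 + y) * (x * y) ^ k * (1 + x)) = 1 * 0 ^ k" for k
    using word(1)[of "[]" "[]" k] word(1)[of "[(2, y)]" "[]" k] word(1)[of "[]" "[(1, x)]" k]
      word(1)[of "[(2, y)]" "[(1, x)]" k]
    unfolding prod_list_xy_word expand add[OF lin(1)] by (cases "k = 0") (simp_all add: mult.assoc)
  from coeffwise_geo[OF lin(1) xy0(1) _ this]
  show "coeffwise \<psi> ((1 + y) * geo (x * y) * (1 + x)) = 1" by simp
  have "coeffwise \<phi> ((1 + y) * (x * y) ^ k * (1 + x)) = (1 + \<xi>) * (1 + \<eta>) * (\<xi> * \<eta>) ^ k" for k
    using word(2)[of "[]" "[]" k] word(2)[of "[(2, y)]" "[]" k] word(2)[of "[]" "[(1, x)]" k]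
      word(2)[of "[(2, y)]" "[(1, x)]" k]
    unfolding prod_list_xy_word expand add[OF lin(2)] by (simp add: \<xi>_def \<eta>_def mult.assoc) (simp add: algebra_simps)
  from coeffwise_geo[OF lin(2) xy0 this]
  show "coeffwise \<phi> ((1 + y) * geo (x * y) * (1 + x)) * (1 - \<xi> * \<eta>) = (1 + \<xi>) * (1 + \<eta>)" .
  \<comment> \<open>These words start in the first algebra and end in the second, so the cyclic
    clause for \<open>\<omega>\<close> applies.\<close>
  have cyc: "coeffwise \<omega> (prod_list (map snd ([] @ xy_word x y k @ [(1, p), (2, q)])))
      = prod_list (map (coeffwise \<phi> \<circ> snd) ([] @ xy_word x y k @ [(1, p), (2, q)]))"
    if "p \<in> {x, x'}" "q \<in> {y, y'}" for p q k
  proof -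
    have "alternating (xy_word x y k @ [(1, p), (2, q)])"
      by (rule alternating_xy_word) auto
    moreover have "j \<in> {1, 2} \<and> F $ n \<in> A j \<and> \<psi> (F $ n) = 0"
      if "(j, F) \<in> set (xy_word x y k @ [(1, p), (2, q)])" for j F n
      using that \<open>p \<in> _\<close> \<open>q \<in> _\<close> xy xy' by (auto split: if_splits)
    ultimately show ?thesis
      using free'(3)[of "xy_word x y k @ [(1, p), (2, q)]"] by (simp add: hd_xy_word del: One_nat_def)
  qed
  have "coeffwise \<omega> (1 * (x * y) ^ k * (x' * y + x * y'))
      = (coeffwise \<phi> x' * \<eta> + \<xi> * coeffwise \<phi> y') * (\<xi> * \<eta>) ^ k" for k
    using cyc[of x' y k] cyc[of x y' k] unfolding prod_list_xy_word
    by (simp add: distrib_left add[OF lin(3)] \<xi>_def \<eta>_def algebra_simps)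
  from coeffwise_geo[OF lin(3) xy0 this]
  show "coeffwise \<omega> (geo (x * y) * (x' * y + x * y')) * (1 - \<xi> * \<eta>)
          = coeffwise \<phi> x' * \<eta> + \<xi> * coeffwise \<phi> y'" by simp
qed


section \<open>Scalar series and resolvents\<close>

lemma linear_functionalD:
  assumes "linear_functional scale f"
  shows "additive f" "f (scale c x) = c * f x"
proof -
  interpret Vector_Spaces.linear scale "(*)" f
    using assms by (simp add: linear_functional_def)
  show "additive f" by unfold_locales (rule add)
  show "f (scale c x) = c * f x" by (rule scale)
qed

context unital_complex_algebra
begin

definition emb :: "complex fps \<Rightarrow> 'a fps" where
  "emb f = Abs_fps (\<lambda>n. scale (f $ n) 1)"

lemma emb_mult_nth: "(emb f * F) $ n = (\<Sum>i=0..n. scale (f $ i) (F $ (n - i)))"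
  by (simp add: fps_mult_nth emb_def scale_mult_left)

lemma mult_emb: "F * emb f = emb f * F"
proof (rule fps_ext)
  fix n
  have "(F * emb f) $ n = (\<Sum>i=0..n. scale (f $ (n - i)) (F $ i))"
    by (simp add: fps_mult_nth emb_def scale_mult_right)
  also have "\<dots> = (\<Sum>i=0..n. scale (f $ i) (F $ (n - i)))"
    by (rule sum.reindex_bij_witness[of _ "\<lambda>i. n - i" "\<lambda>i. n - i"]) auto
  finally show "(F * emb f) $ n = (emb f * F) $ n" by (simp add: emb_mult_nth)
qed

lemma emb_mult: "emb (f * g) = emb f * emb g"
  by (rule fps_ext) (simp add: emb_mult_nth, simp add: emb_def fps_mult_nth scale_sum_left)

lemma emb_add: "emb (f + g) = emb f + emb g"
  and emb_diff: "emb (f - g) = emb f - emb g"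
  and emb_minus: "emb (- f) = - emb f"
  and emb_1: "emb 1 = 1"
  by (auto simp: emb_def fps_eq_iff scale_left_distrib scale_left_diff_distrib)

lemma deriv_emb: "fps_deriv (emb f) = emb (fps_deriv f)"
proof (rule fps_ext)
  fix n
  have "scale (of_nat m * c) 1 = of_nat m * scale c 1" for m c
    by (induction m) (simp_all add: scale_left_distrib distrib_right)
  from this[of "Suc n"] show "fps_deriv (emb f) $ n = emb (fps_deriv f) $ n"
    by (simp add: emb_def del: of_nat_Suc)
qed

lemma coeffwise_emb_mult:
  assumes "linear_functional scale f"
  shows "coeffwise f (emb g * F) = g * coeffwise f F"
  by (rule fps_ext)
    (simp add: emb_mult_nth fps_mult_nth[of g] additive.sum linear_functionalD[OF assms])

text \<open>This is the inverse of 1 - u c. With u = 1/W it equals W (W - c)^(-1), which, unlike W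
  itself, is a power series in 1/z.\<close>

definition resolvent :: "complex fps \<Rightarrow> 'a \<Rightarrow> 'a fps" where
  "resolvent u c = geo (emb u * fps_const c)"

lemma resolvent_nth: "resolvent u c $ n = (\<Sum>k\<le>n. scale (u ^ k $ n) (c ^ k))"
proof -
  have "(emb u * fps_const c) ^ k = emb (u ^ k) * fps_const (c ^ k)" for k
  proof (induction k)
    case (Suc k)
    have "(emb u * fps_const c) ^ Suc k = emb u * (fps_const c * emb (u ^ k)) * fps_const (c ^ k)"
      by (simp add: Suc.IH mult.assoc)
    also have "\<dots> = emb (u ^ Suc k) * fps_const (c ^ Suc k)"
      unfolding mult_emb[of "fps_const c"] by (simp add: emb_mult mult.assoc flip: fps_const_mult)
    finally show ?case .
  qed (simp add: emb_1)
  then show ?thesis by (simp add: resolvent_def geo_def emb_def scale_mult_left)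
qed

lemma resolvent_inverse:
  assumes "u $ 0 = 0"
  shows "emb u * (fps_const c * resolvent u c) = resolvent u c - 1"
    and "emb u * (resolvent u c * fps_const c) = resolvent u c - 1"
proof -
  have 0: "(emb u * fps_const c) $ 0 = 0" using assms by (simp add: emb_def)
  show "emb u * (fps_const c * resolvent u c) = resolvent u c - 1"
    using geo_inverse(1)[OF 0] by (simp add: resolvent_def left_diff_distrib mult.assoc)
      (metis add_diff_cancel_left' diff_add_cancel)
  have "resolvent u c * (emb u * fps_const c) = resolvent u c - 1"
    using geo_inverse(2)[OF 0] by (simp add: resolvent_def right_diff_distrib)
      (metis add_diff_cancel_left' diff_add_cancel)
  then show "emb u * (resolvent u c * fps_const c) = resolvent u c - 1"
    by (simp only: mult.assoc[symmetric] mult_emb)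
qed

text \<open>Applying \<open>f\<close> termwise gives the moment series evaluated at
  \<open>u\<close>; the extra factor \<open>u\<close> is the leading \<open>fps_X\<close> of the
  Cauchy transform after substitution.\<close>

lemma coeffwise_resolvent:
  assumes "linear_functional scale f" "u $ 0 = 0"
  shows "u * coeffwise f (resolvent u c) = cauchy_fps f c oo u"
proof -
  have "coeffwise f (resolvent u c) = Abs_fps (\<lambda>n. f (c ^ n)) oo u"
    by (rule fps_ext)
      (simp add: resolvent_nth fps_compose_nth additive.sum linear_functionalD[OF assms(1)]
        mult.commute atLeast0AtMost)
  then show ?thesis
    by (simp add: cauchy_fps_def fps_compose_mult_distrib assms(2))
qed

text \<open>Used as rewrite rules, these collect the central scalar series on the left and merge
  them into one.\<close>

lemma emb_normalize:
  "fps_const c * emb f = emb f * fps_const c"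
  "fps_const c * (emb f * F) = emb f * (fps_const c * F)"
  "resolvent u c * emb f = emb f * resolvent u c"
  "resolvent u c * (emb f * F) = emb f * (resolvent u c * F)"
  "emb f * emb g = emb (f * g)"
  "emb f * (emb g * F) = emb (f * g) * F"
  by (simp_all only: emb_mult mult.assoc[symmetric] mult_emb[of "fps_const c"]
      mult_emb[of "resolvent u c"])

text \<open>With 1/W = H p and \<open>p'\<close> the inverse of \<open>p\<close>, the series
  \<open>M\<close> is H (W - c) = p' (1 - H p c), so the resolvent inverts it. The last claim
  computes the value of a functional on the logarithmic derivative of \<open>M\<close>, cleared of
  denominators.\<close>

lemma pencil_inverse:
  fixes c :: 'a
  assumes p: "p * p' = 1" and H: "H $ 0 = 0"
  defines "M \<equiv> emb p' - emb H * fps_const c" and "N \<equiv> emb p * resolvent (H * p) c"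
  shows "M * N = 1" "N * M = 1"
    and "linear_functional scale f \<Longrightarrow> (H * p) * coeffwise f (N * fps_deriv M)
        = fps_const (f 1) * (fps_deriv H * p)
          - fps_deriv (H * p) * coeffwise f (resolvent (H * p) c)"
proof -
  let ?R = "resolvent (H * p) c" and ?C = "fps_const c"
  have 0: "(H * p) $ 0 = 0" using H by simp
  note R = resolvent_inverse[OF 0, of c]
  have "M * N = emb (p * p') * ?R - emb (H * p) * (?C * ?R)"
    by (simp add: M_def N_def left_diff_distrib mult_ac emb_normalize)
  also have "\<dots> = 1" unfolding R p by (simp add: emb_1)
  finally show "M * N = 1" .
  have "N * M = emb (p * p') * ?R - emb (H * p) * (?R * ?C)"
    by (simp add: M_def N_def right_diff_distrib mult_ac emb_normalize)
  also have "\<dots> = 1" unfolding R p by (simp add: emb_1)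
  finally show "N * M = 1" .
  have dp: "p * fps_deriv p' = - (fps_deriv p * p')"
    using arg_cong[OF p, of fps_deriv] by (simp add: eq_neg_iff_add_eq_0)
  have "(H * p) * fps_deriv p' * p = - (H * fps_deriv p) * (p * p')"
    using dp by algebra
  then have 1: "(H * p) * (fps_deriv p' * p) = - (H * fps_deriv p)"
    using p by (simp add: mult.assoc)
  have "emb (H * p) * (N * fps_deriv M)
      = emb (H * p) * (emb p * ?R * emb (fps_deriv p'))
        - emb (H * p) * (emb p * ?R * (emb (fps_deriv H) * ?C))"
    by (simp add: M_def N_def right_diff_distrib deriv_emb)
  \<comment> \<open>The factor H p is what allows u R c to be replaced by R - 1 for u = H p, leaving
    an expression linear in the resolvent.\<close>
  also have "\<dots> = emb ((H * p) * (fps_deriv p' * p)) * ?R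
      - emb (fps_deriv H * p) * (emb (H * p) * (?R * ?C))"
    by (simp add: mult_ac emb_normalize)
  also have "\<dots> = emb (fps_deriv H * p) * 1 + emb (- fps_deriv (H * p)) * ?R"
    unfolding R 1 by (simp add: algebra_simps emb_add emb_diff emb_minus)
  finally have *: "emb (H * p) * (N * fps_deriv M)
      = emb (fps_deriv H * p) * 1 + emb (- fps_deriv (H * p)) * ?R" .
  assume f: "linear_functional scale f"
  have add: "coeffwise f (F + G) = coeffwise f F + coeffwise f G" for F G
    by (rule fps_ext) (simp add: additive.add[OF linear_functionalD(1)[OF f]])
  have "coeffwise f 1 = fps_const (f 1)"
    by (rule fps_ext) (simp add: additive.zero[OF linear_functionalD(1)[OF f]])
  then have "(H * p) * coeffwise f (N * fps_deriv M)
      = (fps_deriv H * p) * fps_const (f 1) + - fps_deriv (H * p) * coeffwise f ?R"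
    using arg_cong[OF *, of "coeffwise f"] by (simp only: add coeffwise_emb_mult[OF f])
  then show "(H * p) * coeffwise f (N * fps_deriv M)
        = fps_const (f 1) * (fps_deriv H * p) - fps_deriv (H * p) * coeffwise f ?R"
    by (simp only: mult.commute[of "fps_const (f 1)"] mult_minus_left diff_conv_add_uminus)
qed

section \<open>Centred resolvents and the resolvent of the sum\<close>

lemma unital_subalgebra_closed:
  assumes "unital_subalgebra scale S"
  shows "x \<in> S \<Longrightarrow> y \<in> S \<Longrightarrow> x - y \<in> S"
    and "(\<And>i. i \<in> I \<Longrightarrow> g i \<in> S) \<Longrightarrow> sum g I \<in> S"
    and "x \<in> S \<Longrightarrow> x ^ n \<in> S"
    and "x \<in> S \<Longrightarrow> of_nat n * x \<in> S"
proof -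
  have 0: "0 \<in> S"
    using assms scale_zero_left[of 1] unfolding unital_subalgebra_def by metis
  show "x - y \<in> S" if "x \<in> S" "y \<in> S"
  proof -
    have "x + scale (-1) y \<in> S" using that assms unfolding unital_subalgebra_def by blast
    then show ?thesis by simp
  qed
  show "sum g I \<in> S" if "\<And>i. i \<in> I \<Longrightarrow> g i \<in> S"
    using that by (induction I rule: infinite_finite_induct)
      (use 0 assms in \<open>auto simp: unital_subalgebra_def\<close>)
  show "x ^ n \<in> S" if "x \<in> S"
    using that by (induction n) (use assms in \<open>auto simp: unital_subalgebra_def\<close>)
  show "of_nat n * x \<in> S" if "x \<in> S"
    using that by (induction n) (use 0 assms in \<open>auto simp: unital_subalgebra_def distrib_right\<close>)
qed

text \<open>The subordination equation says that \<open>\<psi>\<close> of the inverse of H (W - c),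
  multiplied by H, is H again. Cancelling H gives the value 1, so subtracting 1 centres every
  coefficient. Coefficients of the derivative are integer multiples of these.\<close>

lemma centred_resolvent:
  fixes c :: 'a
  assumes \<psi>: "linear_functional scale \<psi>" "\<psi> 1 = 1"
    and H: "H $ 0 = 0" "H \<noteq> 0" and p: "p $ 0 = 1"
    and sub: "cauchy_fps \<psi> c oo (H * p) = H"
  defines "x \<equiv> emb p * resolvent (H * p) c - 1"
  shows "x $ 0 = 0"
    and "x $ n \<in> generated_subalgebra scale {c}" "\<psi> (x $ n) = 0"
    and "fps_deriv x $ n \<in> generated_subalgebra scale {c}" "\<psi> (fps_deriv x $ n) = 0"
proof -
  let ?S = "generated_subalgebra scale {c}"
  note S = unital_subalgebra_generated[of scale "{c}"]
  have c: "c \<in> ?S" unfolding generated_subalgebra_def by (rule hull_inc) simp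
  have sc: "scale k z \<in> ?S" if "z \<in> ?S" for k z
    using S that unfolding unital_subalgebra_def by blast
  have 1: "1 $ n \<in> ?S" for n
    using S sc[of 1 0] by (auto simp: unital_subalgebra_def)
  have xS: "x $ n \<in> ?S" for n
    unfolding x_def fps_sub_nth emb_mult_nth resolvent_nth
    by (intro unital_subalgebra_closed[OF S] sc c 1)
  show "x $ n \<in> ?S" by (rule xS)
  show "fps_deriv x $ n \<in> ?S"
    unfolding fps_deriv_nth by (intro unital_subalgebra_closed[OF S] xS)
  show "x $ 0 = 0"
    using p by (simp add: x_def resolvent_nth) (simp add: emb_def)
  have Hp: "(H * p) $ 0 = 0" using H(1) by simp
  have "H * (p * coeffwise \<psi> (resolvent (H * p) c)) = H * 1"
    using coeffwise_resolvent[OF \<psi>(1) Hp, of c] sub by (simp add: mult.assoc)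
  then have "coeffwise \<psi> (emb p * resolvent (H * p) c) = 1"
    using H(2) unfolding coeffwise_emb_mult[OF \<psi>(1)] mult_left_cancel[OF H(2)] by simp
  then have "\<psi> ((emb p * resolvent (H * p) c) $ n) = 1 $ n" for n
    by (metis coeffwise_nth)
  moreover note add = linear_functionalD(1)[OF \<psi>(1)]
  ultimately have x0: "\<psi> (x $ n) = 0" for n
    using \<psi>(2) by (simp add: x_def additive.diff[OF add] additive.zero[OF add])
  show "\<psi> (x $ n) = 0" by (rule x0)
  have "\<psi> (of_nat m * z) = of_nat m * \<psi> z" for m z
    by (induction m) (simp_all add: distrib_right additive.add[OF add] additive.zero[OF add])
  then show "\<psi> (fps_deriv x $ n) = 0" unfolding fps_deriv_nth by (simp only: x0 mult_zero_right)
qed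

text \<open>Applied with \<open>1/W\<^sub>a = H p\<close>, \<open>1/W\<^sub>b = H q\<close> and \<open>1/Z = H r\<close>; the series \<open>K\<^sub>a\<close>, \<open>K\<^sub>b\<close> and \<open>- K\<close>
  are the values of \<open>\<omega>\<close> on the logarithmic derivatives of the three factors.\<close>

lemma cyclically_cond_free_sum:
  fixes a b :: 'a
  assumes lin: "linear_functional scale \<psi>" "linear_functional scale \<phi>" "linear_functional scale \<omega>"
    and one: "\<psi> 1 = 1" "\<phi> 1 = 1" and tr: "tracial \<omega>"
    and free: "cyclically_cond_free_elements scale \<psi> \<phi> \<omega> a b"
    and H: "H $ 0 = 0" "H \<noteq> 0" and p: "p $ 0 = 1" "p * p' = 1" and q: "q $ 0 = 1" "q * q' = 1"
    and r: "r * (p' + q' - 1) = 1"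
    and sub: "cauchy_fps \<psi> a oo (H * p) = H" "cauchy_fps \<psi> b oo (H * q) = H"
  obtains \<xi> \<eta> K\<^sub>a K\<^sub>b K where
    "\<xi> $ 0 = 0" "\<eta> $ 0 = 0"
    "cauchy_fps \<psi> (a + b) oo (H * r) = H"
    "cauchy_fps \<phi> a oo (H * p) = H * (1 + \<xi>)"
    "cauchy_fps \<phi> b oo (H * q) = H * (1 + \<eta>)"
    "(cauchy_fps \<phi> (a + b) oo (H * r)) * (1 - \<xi> * \<eta>) = H * ((1 + \<xi>) * (1 + \<eta>))"
    "(H * p)\<^sup>2 * K\<^sub>a = fps_const (\<omega> 1) * (fps_deriv H * p) * (H * p)
       - fps_deriv (H * p) * (cauchy_fps \<omega> a oo (H * p))"
    "(H * q)\<^sup>2 * K\<^sub>b = fps_const (\<omega> 1) * (fps_deriv H * q) * (H * q)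
       - fps_deriv (H * q) * (cauchy_fps \<omega> b oo (H * q))"
    "(H * r)\<^sup>2 * (K\<^sub>a + K\<^sub>b - K) = fps_const (\<omega> 1) * (fps_deriv H * r) * (H * r)
       - fps_deriv (H * r) * (cauchy_fps \<omega> (a + b) oo (H * r))"
    "K * (1 - \<xi> * \<eta>) = fps_deriv (\<xi> * \<eta>)"
proof -
  note add = lin[THEN linear_functionalD(1)]
  \<comment> \<open>\<open>M p' c\<close> is H (W - c) for 1/W = H p, and \<open>N p c\<close> is
    its inverse; all three pencils are instances.\<close>
  define N where "N p c = emb p * resolvent (H * p) c" for p c
  define M where "M p' c = emb p' - emb H * fps_const c" for p' c
  define x where "x = N p a - 1"
  define y where "y = N q b - 1"
  define \<xi> where "\<xi> = coeffwise \<phi> x"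
  define \<eta> where "\<eta> = coeffwise \<phi> y"
  have MN: "M p' c * N p c = 1" "N p c * M p' c = 1" if "p * p' = 1" for p p' c
    using pencil_inverse(1,2)[OF that H(1)] by (simp_all add: M_def N_def)
  have Hp: "(H * p) $ 0 = 0" for p using H(1) by simp
  have coeff_N: "H * coeffwise f (N p c) = cauchy_fps f c oo (H * p)"
    if "linear_functional scale f" for f p c
    using coeffwise_resolvent[OF that Hp, of p c]
    by (simp add: N_def coeffwise_emb_mult[OF that] mult.assoc)
  have log_deriv: "(H * p)\<^sup>2 * coeffwise \<omega> (N p c * fps_deriv (M p' c))
      = fps_const (\<omega> 1) * (fps_deriv H * p) * (H * p) - fps_deriv (H * p) * (cauchy_fps \<omega> c oo (H * p))"
    if "p * p' = 1" for p p' c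
    using pencil_inverse(3)[OF that H(1) lin(3), of c, folded M_def N_def]
    unfolding coeffwise_resolvent[OF lin(3) Hp, symmetric]
    by (simp add: power2_eq_square mult.assoc right_diff_distrib)
  have x: "x $ 0 = 0" "x $ n \<in> generated_subalgebra scale {a} \<and> \<psi> (x $ n) = 0"
    "fps_deriv x $ n \<in> generated_subalgebra scale {a} \<and> \<psi> (fps_deriv x $ n) = 0" for n
    using centred_resolvent[OF lin(1) one(1) H p(1) sub(1)] by (simp_all add: x_def N_def)
  have y: "y $ 0 = 0" "y $ n \<in> generated_subalgebra scale {b} \<and> \<psi> (y $ n) = 0"
    "fps_deriv y $ n \<in> generated_subalgebra scale {b} \<and> \<psi> (fps_deriv y $ n) = 0" for n
    using centred_resolvent[OF lin(1) one(1) H q(1) sub(2)] by (simp_all add: y_def N_def)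
  have \<xi>\<eta>0: "\<xi> $ 0 = 0" "\<eta> $ 0 = 0"
    using x(1) y(1) by (simp_all add: \<xi>_def \<eta>_def additive.zero[OF add(2)])
  define S where "S j = generated_subalgebra scale {if j = 1 then a else b}" for j :: nat
  have free': "cyclically_cond_free \<psi> \<phi> \<omega> S"
    using free unfolding cyclically_cond_free_elements_def S_def .
  have S1: "x $ n \<in> S 1 \<and> \<psi> (x $ n) = 0" and S2: "y $ n \<in> S 2 \<and> \<psi> (y $ n) = 0"
    and S1': "fps_deriv x $ n \<in> S 1 \<and> \<psi> (fps_deriv x $ n) = 0"
    and S2': "fps_deriv y $ n \<in> S 2 \<and> \<psi> (fps_deriv y $ n) = 0" for n
    using x(2,3)[of n] y(2,3)[of n] by (simp_all add: S_def del: fps_deriv_nth)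
  note xy = cyclically_cond_free_xy[OF add one free' S1 S2 S1' S2' x(1) y(1), folded \<xi>_def \<eta>_def]

  define Y where "Y = geo (x * y)"
  have "(x * y) $ 0 = 0" using x(1) by simp
  note Y = geo_inverse[OF this, folded Y_def]
  let ?Ma = "M p' a" and ?Mb = "M q' b" and ?Mc = "M (p' + q' - 1) (a + b)"
  have Na: "N p a = 1 + x" and Nb: "N q b = 1 + y" by (simp_all add: x_def y_def)
  note A = MN[OF p(2), of a, unfolded Na] and B = MN[OF q(2), of b, unfolded Nb]
  have Mc: "?Mc = ?Ma + ?Mb - 1"
    by (simp add: M_def emb_add emb_diff emb_1 distrib_left flip: fps_const_add)
  \<comment> \<open>Multiplying by the inverses of \<open>?Ma\<close> on the left and of
    \<open>?Mb\<close> on the right turns \<open>?Ma + ?Mb - 1\<close> into (1 + y) + (1 + x) - (1 +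
    x) (1 + y).\<close>
  have "(1 + x) * ?Mc * (1 + y)
      = ((1 + x) * ?Ma) * (1 + y) + (1 + x) * (?Mb * (1 + y)) - (1 + x) * (1 + y)"
    unfolding Mc by (simp add: algebra_simps)
  also have "\<dots> = 1 - x * y" unfolding A B by (simp add: algebra_simps)
  finally have "?Ma * ((1 + x) * ?Mc * (1 + y)) * ?Mb = ?Ma * (1 - x * y) * ?Mb" by simp
  moreover have "?Ma * ((1 + x) * ?Mc * (1 + y)) * ?Mb
      = (?Ma * (1 + x)) * ?Mc * ((1 + y) * ?Mb)" by (simp only: mult.assoc)
  ultimately have factor: "?Mc = ?Ma * (1 - x * y) * ?Mb" unfolding A B by simp
  have "?Mc * ((1 + y) * Y * (1 + x)) = ?Ma * ((1 - x * y) * (?Mb * (1 + y)) * Y) * (1 + x)"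
    unfolding factor by (simp only: mult.assoc)
  also have "\<dots> = 1" unfolding B by (simp add: Y A)
  \<comment> \<open>\<open>N r (a + b)\<close> is a left inverse of \<open>?Mc\<close> and the
    product on the right is a right inverse, so they agree.\<close>
  finally have Nc: "N r (a + b) = (1 + y) * Y * (1 + x)"
    using left_inverse_eq_right_inverse[OF MN(2)[OF r, of "a + b"]] by simp

  have \<psi>c: "coeffwise \<psi> (N r (a + b)) = 1"
    and \<phi>c: "coeffwise \<phi> (N r (a + b)) * (1 - \<xi> * \<eta>) = (1 + \<xi>) * (1 + \<eta>)"
    and K: "coeffwise \<omega> (Y * (fps_deriv x * y + x * fps_deriv y)) * (1 - \<xi> * \<eta>)
      = coeffwise \<phi> (fps_deriv x) * \<eta> + \<xi> * coeffwise \<phi> (fps_deriv y)"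
    unfolding Nc Y_def by (fact xy)+

  have add_\<omega>: "coeffwise \<omega> (F + G) = coeffwise \<omega> F + coeffwise \<omega> G"
    "coeffwise \<omega> (F - G) = coeffwise \<omega> F - coeffwise \<omega> G" for F G
    by (simp_all add: fps_eq_iff additive.add[OF add(3)] additive.diff[OF add(3)])
  note comm = coeffwise_commute[OF add(3) tr]
  let ?Z = "fps_deriv x * y + x * fps_deriv y"
  \<comment> \<open>The product rule for the three factors; the derivative of the middle one is
    \<open>- ?Z\<close>.\<close>
  have "fps_deriv ?Mc = ?Ma * (1 - x * y) * fps_deriv ?Mb
      + (fps_deriv ?Ma * (1 - x * y) - ?Ma * ?Z) * ?Mb"
    unfolding factor by (simp add: algebra_simps)
  moreover have "n * Y * m * (A * D * B' + (A' * D - A * Z) * B)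
      = n * (Y * ((m * A) * D)) * B' + n * Y * m * A' * D * B - n * Y * (m * A) * Z * B"
    for n m A A' B B' D Z :: "'a fps"
    by (simp only: distrib_left distrib_right right_diff_distrib left_diff_distrib mult.assoc
        add_diff_eq)
  ultimately have "N r (a + b) * fps_deriv ?Mc
      = (1 + y) * (Y * (((1 + x) * ?Ma) * (1 - x * y))) * fps_deriv ?Mb
        + (1 + y) * Y * (1 + x) * fps_deriv ?Ma * (1 - x * y) * ?Mb
        - (1 + y) * Y * ((1 + x) * ?Ma) * ?Z * ?Mb"
    unfolding Nc by simp
  also have "\<dots> = (1 + y) * fps_deriv ?Mb
        + ((1 + y) * Y) * ((1 + x) * fps_deriv ?Ma * (1 - x * y) * ?Mb)
        - ((1 + y)) * (Y * ?Z * ?Mb)"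
    unfolding A by (simp add: Y mult.assoc)
  \<comment> \<open>The trace moves \<open>(1 + y) * Y\<close>, respectively \<open>1 + y\<close>,
    to the far right, where it cancels against \<open>(1 - x * y) * ?Mb\<close>, respectively
    \<open>?Mb\<close>.\<close>
  finally have "coeffwise \<omega> (N r (a + b) * fps_deriv ?Mc)
      = coeffwise \<omega> ((1 + y) * fps_deriv ?Mb)
        + coeffwise \<omega> ((1 + x) * fps_deriv ?Ma * ((1 - x * y) * (?Mb * (1 + y)) * Y))
        - coeffwise \<omega> (Y * ?Z * (?Mb * (1 + y)))"
    using comm[of "(1 + y) * Y" "(1 + x) * fps_deriv ?Ma * (1 - x * y) * ?Mb"]
      comm[of "1 + y" "Y * ?Z * ?Mb"]
    by (simp only: add_\<omega> mult.assoc)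
  then have \<omega>c: "coeffwise \<omega> (N r (a + b) * fps_deriv ?Mc)
      = coeffwise \<omega> (N p a * fps_deriv ?Ma) + coeffwise \<omega> (N q b * fps_deriv ?Mb)
        - coeffwise \<omega> (Y * ?Z)"
    unfolding B Na Nb by (simp add: Y)

  have deriv: "coeffwise \<phi> (fps_deriv F) = fps_deriv (coeffwise \<phi> F)" for F
  proof (rule fps_ext)
    fix n
    have "\<phi> (of_nat m * z) = of_nat m * \<phi> z" for m z
      by (induction m) (simp_all add: distrib_right additive.add[OF add(2)] additive.zero[OF add(2)])
    then show "coeffwise \<phi> (fps_deriv F) $ n = fps_deriv (coeffwise \<phi> F) $ n"
      by (simp only: coeffwise_nth fps_deriv_nth)
  qed
  have 1: "coeffwise \<phi> (1 + F) = 1 + coeffwise \<phi> F" for F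
    by (rule fps_ext) (simp add: additive.add[OF add(2)] one additive.zero[OF add(2)])
  show thesis
  proof
    show "\<xi> $ 0 = 0" "\<eta> $ 0 = 0" by (fact \<xi>\<eta>0)+
    show "cauchy_fps \<psi> (a + b) oo (H * r) = H"
      using coeff_N[OF lin(1), of r "a + b"] \<psi>c by simp
    show "cauchy_fps \<phi> a oo (H * p) = H * (1 + \<xi>)"
      using coeff_N[OF lin(2), of p a] by (simp add: Na 1 \<xi>_def)
    show "cauchy_fps \<phi> b oo (H * q) = H * (1 + \<eta>)"
      using coeff_N[OF lin(2), of q b] by (simp add: Nb 1 \<eta>_def)
    show "(cauchy_fps \<phi> (a + b) oo (H * r)) * (1 - \<xi> * \<eta>) = H * ((1 + \<xi>) * (1 + \<eta>))"
      unfolding coeff_N[OF lin(2), of r "a + b", symmetric] mult.assoc \<phi>c ..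
    show "coeffwise \<omega> (Y * ?Z) * (1 - \<xi> * \<eta>) = fps_deriv (\<xi> * \<eta>)"
      unfolding K deriv by (simp add: \<xi>_def \<eta>_def algebra_simps)
  qed (fact log_deriv[OF p(2)] log_deriv[OF q(2)] log_deriv[OF r, of "a + b", unfolded \<omega>c])+
qed

end


section \<open>Return to Laurent series and comparison of logarithmic derivatives\<close>

lemma zcompose_inverse_fps:
  assumes "u \<noteq> 0" "u $ 0 = 0"
  shows "zcompose (cauchy f c) (inverse (fps_to_fls u)) = fps_to_fls (cauchy_fps f c oo u)"
    and "zderiv (inverse (fps_to_fls u))
      = fls_X\<^sup>2 * fps_to_fls (fps_deriv u) / (fps_to_fls u)\<^sup>2"
    and "zcompose (zderiv (cauchy f c)) (inverse (fps_to_fls u))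
      / zcompose (cauchy f c) (inverse (fps_to_fls u)) * zderiv (inverse (fps_to_fls u))
      = - fls_X\<^sup>2 * (fps_to_fls (fps_deriv (cauchy_fps f c oo u)) / fps_to_fls (cauchy_fps f c oo u))"
proof -
  show 1: "zcompose (cauchy f c) (inverse (fps_to_fls u)) = fps_to_fls (cauchy_fps f c oo u)"
    using assms by (simp add: zcompose_def cauchy_def)
  show 2: "zderiv (inverse (fps_to_fls u))
      = fls_X\<^sup>2 * fps_to_fls (fps_deriv u) / (fps_to_fls u)\<^sup>2"
    by (simp add: zderiv_def fls_inverse_deriv' fls_deriv_fps_to_fls)
  \<comment> \<open>The factor u^2 arising here cancels against the denominator of the derivative of
    W = 1/u, and the chain rule leaves a logarithmic derivative of the composite.\<close>
  have "zcompose (zderiv (cauchy f c)) (inverse (fps_to_fls u))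
      = - (fps_to_fls u)\<^sup>2 * fps_to_fls (fps_deriv (cauchy_fps f c) oo u)"
    using assms by (simp add: zcompose_def zderiv_def cauchy_def fls_deriv_fps_to_fls
        fls_compose_fps_mult fls_compose_fps_power)
  then show "zcompose (zderiv (cauchy f c)) (inverse (fps_to_fls u))
      / zcompose (cauchy f c) (inverse (fps_to_fls u)) * zderiv (inverse (fps_to_fls u))
      = - fls_X\<^sup>2 * (fps_to_fls (fps_deriv (cauchy_fps f c oo u)) / fps_to_fls (cauchy_fps f c oo u))"
    unfolding 1 2 using assms by (simp add: fps_compose_deriv fls_times_fps_to_fls)
qed

lemma fls_log_deriv_mult:
  fixes f g :: "complex fls"
  assumes "f \<noteq> 0" "g \<noteq> 0"
  shows "fls_deriv (f * g) / (f * g) = fls_deriv f / f + fls_deriv g / g"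
  using assms by (simp add: field_simps)

text \<open>Solves the identities for \<open>K\<^sub>a\<close>, \<open>K\<^sub>b\<close> and
  \<open>K\<close> for the \<open>\<omega>\<close>-transform. The free factor \<open>e\<close>
  covers both z-derivatives, where it is the square of \<open>fls_X\<close>, and the transform of
  the sum itself.\<close>

lemma log_deriv_solve:
  fixes h r :: "'a::field"
  assumes "h \<noteq> 0" "r \<noteq> 0" and "(h * r)\<^sup>2 * K = c * (h' * r) * (h * r) - d * G"
  shows "G * (e * d / (h * r)\<^sup>2) = e * (c * (h' / h) - K)"
proof -
  have "G * (e * d / (h * r)\<^sup>2) = e * (c * (h' * r) * (h * r) - (h * r)\<^sup>2 * K) / (h * r)\<^sup>2"
    unfolding assms(3) by (simp add: mult_ac)
  also have "\<dots> = e * (c * (h' / h) - K)"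
    using assms(1,2) by (simp add: divide_simps) (simp add: algebra_simps power2_eq_square)
  finally show ?thesis .
qed

text \<open>Both 1/W and the transform H of \<open>s\<close> start with \<open>fps_X\<close>, so
  their quotient \<open>p\<close> is a power series with constant term 1. Thus H W = 1/p is a power
  series too, and H (W - c) has no pole.\<close>

lemma subordination_factor:
  fixes f :: "'a::ring_1 \<Rightarrow> complex"
  assumes "f 1 = 1"
  obtains p where "p $ 0 = 1" "cauchy_fps f c oo (cauchy_fps f s * p) = cauchy_fps f s"
    "subordination f c s = inverse (fps_to_fls (cauchy_fps f s * p))"
proof -
  define g where "g = cauchy_fps f c"
  define H where "H = cauchy_fps f s"
  define u where "u = fps_inv g oo H"
  define p where "p = fps_shift 1 u * inverse (fps_shift 1 H)"
  have g: "g $ 0 = 0" "g $ Suc 0 = 1" and H: "H $ 0 = 0" "H $ Suc 0 = 1"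
    using assms by (simp_all add: g_def H_def)
  have inv: "fps_inv g $ 0 = 0" "fps_inv g $ Suc 0 = 1"
    using g by (simp_all add: fps_inv_def)
  have u: "u $ 0 = 0" "u $ Suc 0 = 1"
    using inv H by (simp_all add: u_def fps_compose_nth)
  have shift: "F = fps_X * fps_shift 1 F" if "F $ 0 = 0" for F :: "complex fps"
    by (rule fps_ext) (use that in \<open>simp add: fps_X_mult_nth\<close>)
  have "H * p = fps_X * fps_shift 1 u * (fps_shift 1 H * inverse (fps_shift 1 H))"
    using shift[OF H(1)] by (simp add: p_def mult_ac)
  also have "\<dots> = fps_X * fps_shift 1 u"
    using H(2) inverse_mult_eq_1'[of "fps_shift 1 H"] by simp
  also have "\<dots> = u" using shift[OF u(1)] ..
  finally have Hp: "H * p = u" .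
  have "g oo u = (g oo fps_inv g) oo H"
    unfolding u_def by (rule fps_compose_assoc) (simp_all add: H inv)
  also have "\<dots> = H" using g H by (simp add: fps_inv_right)
  finally have "g oo (H * p) = H" unfolding Hp .
  moreover have "H \<noteq> 0" using H by auto
  then have "subordination f c s = inverse (fps_to_fls u)"
    using H by (simp add: subordination_def comp_inverse_def u_def fls_compose_fps_inverse
        flip: g_def H_def)
  moreover have "p $ 0 = 1" using u H by (simp add: p_def)
  ultimately show thesis using that Hp unfolding g_def H_def by metis
qed

theorem proposition4p4:
  fixes scale :: "complex \<Rightarrow> 'a::ring_1 \<Rightarrow> 'a"
    and \<psi> \<phi> \<omega> :: "'a \<Rightarrow> complex"
    and a b :: 'a
    and W\<^sub>a W\<^sub>b :: "complex fls"
  assumes "unital_complex_algebra scale"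
    and "linear_functional scale \<psi>" and "\<psi> 1 = 1"
    and "linear_functional scale \<phi>" and "\<phi> 1 = 1"
    and "linear_functional scale \<omega>" and "tracial \<omega>"
    and "cyclically_cond_free_elements scale \<psi> \<phi> \<omega> a b"
    and "W\<^sub>a = subordination \<psi> a (a + b)"
    and "W\<^sub>b = subordination \<psi> b (a + b)"
  shows "cauchy \<omega> (a + b) =
      zcompose (cauchy \<omega> a) W\<^sub>a * zderiv W\<^sub>a + zcompose (cauchy \<omega> b) W\<^sub>b * zderiv W\<^sub>b
      - fls_const (1 - \<omega> 1) * (zderiv (cauchy \<psi> (a + b)) / cauchy \<psi> (a + b))
      + zcompose (zderiv (cauchy \<phi> a)) W\<^sub>a / zcompose (cauchy \<phi> a) W\<^sub>a * zderiv W\<^sub>a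
      + zcompose (zderiv (cauchy \<phi> b)) W\<^sub>b / zcompose (cauchy \<phi> b) W\<^sub>b * zderiv W\<^sub>b
      - zderiv (cauchy \<phi> (a + b)) / cauchy \<phi> (a + b)"
proof -
  interpret unital_complex_algebra scale by fact
  define H where "H = cauchy_fps \<psi> (a + b)"
  have H: "H $ 0 = 0" "H $ Suc 0 = 1" using assms by (simp_all add: H_def)
  then have H0: "H \<noteq> 0" by auto
  obtain p where p: "p $ 0 = 1" and pa: "cauchy_fps \<psi> a oo (H * p) = H"
    and Wa: "W\<^sub>a = inverse (fps_to_fls (H * p))"
    using subordination_factor[of \<psi> a "a + b"] assms unfolding H_def by metis
  obtain q where q: "q $ 0 = 1" and qb: "cauchy_fps \<psi> b oo (H * q) = H"
    and Wb: "W\<^sub>b = inverse (fps_to_fls (H * q))"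
    using subordination_factor[of \<psi> b "a + b"] assms unfolding H_def by metis
  \<comment> \<open>Chosen so that 1/(H r) = \<open>W\<^sub>a\<close> + \<open>W\<^sub>b\<close> -
    1/H.\<close>
  define r where "r = inverse (inverse p + inverse q - 1)"
  have p': "p * inverse p = 1" and q': "q * inverse q = 1"
    and r: "r * (inverse p + inverse q - 1) = 1"
    using p q by (simp_all add: r_def inverse_mult_eq_1 inverse_mult_eq_1')
  obtain \<xi> \<eta> K\<^sub>a K\<^sub>b K where \<xi>\<eta>: "\<xi> $ 0 = 0" "\<eta> $ 0 = 0"
    and \<psi>: "cauchy_fps \<psi> (a + b) oo (H * r) = H"
    and \<phi>a: "cauchy_fps \<phi> a oo (H * p) = H * (1 + \<xi>)"
    and \<phi>b: "cauchy_fps \<phi> b oo (H * q) = H * (1 + \<eta>)"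
    and \<phi>c: "(cauchy_fps \<phi> (a + b) oo (H * r)) * (1 - \<xi> * \<eta>) = H * ((1 + \<xi>) * (1 + \<eta>))"
    and Ka: "(H * p)\<^sup>2 * K\<^sub>a = fps_const (\<omega> 1) * (fps_deriv H * p) * (H * p)
       - fps_deriv (H * p) * (cauchy_fps \<omega> a oo (H * p))"
    and Kb: "(H * q)\<^sup>2 * K\<^sub>b = fps_const (\<omega> 1) * (fps_deriv H * q) * (H * q)
       - fps_deriv (H * q) * (cauchy_fps \<omega> b oo (H * q))"
    and Kc: "(H * r)\<^sup>2 * (K\<^sub>a + K\<^sub>b - K) = fps_const (\<omega> 1) * (fps_deriv H * r) * (H * r)
       - fps_deriv (H * r) * (cauchy_fps \<omega> (a + b) oo (H * r))"
    and K: "K * (1 - \<xi> * \<eta>) = fps_deriv (\<xi> * \<eta>)"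
    using cyclically_cond_free_sum[OF assms(2,4,6,3,5,7,8) H(1) H0 p p' q q' r pa qb] by blast
  \<comment> \<open>Since H composed with H r is H, and H is invertible under composition, H r is
    the indeterminate; that is, \<open>W\<^sub>a\<close> + \<open>W\<^sub>b\<close> - 1/H =
    z.\<close>
  have "fps_inv H oo (H oo (H * r)) = (fps_inv H oo H) oo (H * r)"
    using H by (intro fps_compose_assoc) simp_all
  then have Hr: "H * r = fps_X"
    using \<psi> H by (simp add: fps_inv flip: H_def)

  let ?L = fps_to_fls
  define h where "h = ?L H"
  define dl :: "complex fls \<Rightarrow> complex fls" where "dl F = fls_deriv F / F" for F
  have h: "h \<noteq> 0" using H0 by (simp add: h_def)
  have u: "H * p \<noteq> 0" "(H * p) $ 0 = 0" "H * q \<noteq> 0" "(H * q) $ 0 = 0"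
    using H0 H p q by auto
  have ne: "1 + ?L \<xi> \<noteq> 0" "1 + ?L \<eta> \<noteq> 0" "1 - ?L \<xi> * ?L \<eta> \<noteq> 0"
  proof -
    have "(1 + \<xi>) $ 0 \<noteq> 0" "(1 + \<eta>) $ 0 \<noteq> 0" "(1 - \<xi> * \<eta>) $ 0 \<noteq> 0" using \<xi>\<eta> by simp_all
    then have "1 + \<xi> \<noteq> 0" "1 + \<eta> \<noteq> 0" "1 - \<xi> * \<eta> \<noteq> 0" by fastforce+
    from this[THEN fps_to_fls_nonzeroI]
    show "1 + ?L \<xi> \<noteq> 0" "1 + ?L \<eta> \<noteq> 0" "1 - ?L \<xi> * ?L \<eta> \<noteq> 0"
      by (simp_all only: fps_to_fls_plus fps_to_fls_minus fls_times_fps_to_fls fps_one_to_fls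
          not_False_eq_True)
  qed
  \<comment> \<open>From here each summand is written through \<open>dl h\<close>, the logarithmic
    derivatives of \<open>1 + ?L \<xi>\<close> and \<open>1 + ?L \<eta>\<close>, and the images of
    \<open>K\<^sub>a\<close>, \<open>K\<^sub>b\<close>, \<open>K\<close>.\<close>
  have A: "zcompose (zderiv (cauchy \<phi> a)) W\<^sub>a / zcompose (cauchy \<phi> a) W\<^sub>a * zderiv W\<^sub>a
      = - fls_X\<^sup>2 * (dl h + dl (1 + ?L \<xi>))"
    unfolding Wa zcompose_inverse_fps(3)[OF u(1,2)] \<phi>a
    using fls_log_deriv_mult[OF h ne(1)]
    by (simp add: dl_def h_def fls_times_fps_to_fls flip: fls_deriv_fps_to_fls)
  have B: "zcompose (zderiv (cauchy \<phi> b)) W\<^sub>b / zcompose (cauchy \<phi> b) W\<^sub>b * zderiv W\<^sub>b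
      = - fls_X\<^sup>2 * (dl h + dl (1 + ?L \<eta>))"
    unfolding Wb zcompose_inverse_fps(3)[OF u(3,4)] \<phi>b
    using fls_log_deriv_mult[OF h ne(2)]
    by (simp add: dl_def h_def fls_times_fps_to_fls flip: fls_deriv_fps_to_fls)
  have C: "zderiv (cauchy \<phi> (a + b)) / cauchy \<phi> (a + b)
      = - fls_X\<^sup>2 * (dl h + dl (1 + ?L \<xi>) + dl (1 + ?L \<eta>) + ?L K)"
  proof -
    let ?f = "cauchy \<phi> (a + b)"
    have f: "?f * (1 - ?L \<xi> * ?L \<eta>) = h * ((1 + ?L \<xi>) * (1 + ?L \<eta>))"
      using arg_cong[OF \<phi>c, of ?L] by (simp add: Hr fls_times_fps_to_fls cauchy_def h_def)
    then have "?f \<noteq> 0" using h ne by auto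
    \<comment> \<open>\<open>K\<close> is minus the logarithmic derivative of 1 - \<xi> \<eta>, so
      it enters the \<open>\<phi>\<close>-side through the denominator of the product
      formula.\<close>
    moreover have "?L K * (1 - ?L \<xi> * ?L \<eta>) = fls_deriv (?L \<xi> * ?L \<eta>)"
      using arg_cong[OF K, of ?L] by (simp add: fls_times_fps_to_fls fls_deriv_fps_to_fls)
    then have "dl (1 - ?L \<xi> * ?L \<eta>) = - ?L K"
      using ne(3) unfolding dl_def by (simp add: field_simps)
    ultimately have "dl ?f - ?L K = dl h + dl (1 + ?L \<xi>) + dl (1 + ?L \<eta>)"
      using arg_cong[OF f, of dl] h ne
      by (simp add: dl_def fls_log_deriv_mult del: fls_deriv_mult)
    then have "dl ?f = dl h + dl (1 + ?L \<xi>) + dl (1 + ?L \<eta>) + ?L K" by (simp add: algebra_simps)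
    moreover have "zderiv ?f / ?f = - fls_X\<^sup>2 * dl ?f" by (simp add: zderiv_def dl_def)
    ultimately show ?thesis by simp
  qed
  have D: "zderiv (cauchy \<psi> (a + b)) / cauchy \<psi> (a + b) = - fls_X\<^sup>2 * dl h"
    by (simp add: zderiv_def dl_def h_def H_def cauchy_def)
  have E: "zcompose (cauchy \<omega> a) W\<^sub>a * zderiv W\<^sub>a = fls_X\<^sup>2 * (fls_const (\<omega> 1) * dl h - ?L K\<^sub>a)"
  proof -
    have "(h * ?L p)\<^sup>2 * ?L K\<^sub>a = fls_const (\<omega> 1) * (fls_deriv h * ?L p) * (h * ?L p)
        - ?L (fps_deriv (H * p)) * ?L (cauchy_fps \<omega> a oo (H * p))"
      using arg_cong[OF Ka, of ?L]
      by (simp add: h_def fls_times_fps_to_fls fps_to_fls_power fls_deriv_fps_to_fls del: fps_deriv_mult)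
    moreover have "?L p \<noteq> 0" using u by auto
    moreover have "h * ?L p = ?L (H * p)" by (simp add: h_def fls_times_fps_to_fls)
    ultimately show ?thesis
      using log_deriv_solve[OF h, of "?L p"]
      unfolding Wa zcompose_inverse_fps(1,2)[OF u(1,2)] dl_def by metis
  qed
  have F: "zcompose (cauchy \<omega> b) W\<^sub>b * zderiv W\<^sub>b = fls_X\<^sup>2 * (fls_const (\<omega> 1) * dl h - ?L K\<^sub>b)"
  proof -
    have "(h * ?L q)\<^sup>2 * ?L K\<^sub>b = fls_const (\<omega> 1) * (fls_deriv h * ?L q) * (h * ?L q)
        - ?L (fps_deriv (H * q)) * ?L (cauchy_fps \<omega> b oo (H * q))"
      using arg_cong[OF Kb, of ?L]
      by (simp add: h_def fls_times_fps_to_fls fps_to_fls_power fls_deriv_fps_to_fls del: fps_deriv_mult)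
    moreover have "?L q \<noteq> 0" using u by auto
    moreover have "h * ?L q = ?L (H * q)" by (simp add: h_def fls_times_fps_to_fls)
    ultimately show ?thesis
      using log_deriv_solve[OF h, of "?L q"]
      unfolding Wb zcompose_inverse_fps(1,2)[OF u(3,4)] dl_def by metis
  qed
  have G: "cauchy \<omega> (a + b) = fls_X\<^sup>2 * (fls_const (\<omega> 1) * dl h - ?L K\<^sub>a - ?L K\<^sub>b + ?L K)"
  proof -
    have hr: "h * ?L r = fls_X"
      using arg_cong[OF Hr, of ?L] by (simp add: h_def fls_times_fps_to_fls)
    then have r0: "?L r \<noteq> 0" by auto
    have "(h * ?L r)\<^sup>2 * (?L K\<^sub>a + ?L K\<^sub>b - ?L K)
        = fls_const (\<omega> 1) * (fls_deriv h * ?L r) * (h * ?L r) - 1 * cauchy \<omega> (a + b)"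
      using arg_cong[OF Kc, of ?L] unfolding hr unfolding Hr
      by (simp add: h_def fls_times_fps_to_fls fps_to_fls_power fls_deriv_fps_to_fls cauchy_def
          hr[unfolded h_def])
    \<comment> \<open>Because H r is the indeterminate, its derivative is 1; taking \<open>e\<close>
      to be the square of \<open>h * ?L r\<close> cancels the denominator and isolates the
      transform.\<close>
    from log_deriv_solve[OF h r0 this, of "(h * ?L r)\<^sup>2"] show ?thesis
      using h r0 by (simp add: dl_def hr)
  qed
  have const: "fls_const (1 - \<omega> 1) = 1 - fls_const (\<omega> 1)"
    by (intro fls_eqI) simp
  \<comment> \<open>The terms in \<xi> and \<eta> cancel, and the coefficients of
    \<open>dl h\<close> add up to 2 \<omega>(1) + (1 - \<omega>(1)) - 2 + 1 = \<omega>(1).\<close>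
  show ?thesis
    unfolding A B C D E F G const by (simp add: algebra_simps)
qed

end
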